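(* Let $m,n,h\in\mathbb{N}$ with $0\le h\le\min\{m,n\}$, and let $\Phi_{m,n,h}$ be the associated EPOSIC channel. Then $S_{min}(\Phi_{m,n,h})=0$ if and only if $h=0$.
   Context: Conventions: $\mathbb{N}=\{0,1,2,\dots\}$; all vector spaces are finite dimensional and complex. A state of a Hilbert space $H$ is a positive operator in $End(H)$ of trace one; a pure state is one of the form $ww^*$ with $w\in H$ a unit vector (here $uv^*$ denotes the operator $x\mapsto\langle v|x\rangle u$, the inner product being linear in the second variable). A quantum channel $\Phi:End(H)\to End(K)$ is a completely positive trace preserving linear map; operators $T_j:H\to K$ are Kraus operators of $\Phi$ if $\sum_j T_j^*T_j=I_H$ and $\Phi(A)=\sum_jT_jAT_j^*$ for all $A$. Minimal output entropy: $S_{min}(\Phi)=\min_{w\in H,\ \|w\|=1}S(\Phi(ww^* ))$, where $S(\varrho)=-\mathrm{tr}(\varrho\log_2\varrho)=-\sum_i\lambda_i\log_2\lambda_i$ with $\lambda_i$ the eigenvalues of $\varrho$ and $0\log_2 0=0$. EPOSIC channels: for $k\in\mathbb{N}$, $P_k$ is the $(k+1)$-dimensional space of homogeneous complex polynomials of degree $k$ in $x_1,x_2$, with inner product $\langle x_1^lx_2^{k-l},x_1^{l'}x_2^{k-l'}\rangle=l!(k-l)!\,\delta_{ll'}$ and orthonormal basis $f_l^k=\frac{1}{\sqrt{l!(k-l)!}}x_1^lx_2^{k-l}$, $0\le l\le k$. Let $m,n,h\in\mathbb{N}$ with $0\le h\le\min\{m,n\}$ and $r=m+n-2h$. For $0\le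 i\le r$ put $B(i)=\{j\in\mathbb{Z}:\max\{0,-m+i+h\}\le j\le\min\{i+h,n\}\}$, and for $j\in B(i)$ put $l_{ij}=i-j+h$ and $$\varepsilon_i^j=\varepsilon_i^j(m,n,h)=\sum_{s=\max\{0,j-i,j+h-n\}}^{\min\{h,j,j+m-i-h\}}(-1)^s\sqrt{\frac{c_{m,n,h}\,r!\,m!\,n!}{\binom{r}{i}\binom{m}{i-j+h}\binom{n}{j}}}\;\frac{\binom{h}{s}\binom{n-h}{j-s}\binom{m-h}{i-j+s}}{(m-h)!},$$ where $c_{m,n,h}>0$ is the normalization constant for which $\sum_{j\in B(i)}(\varepsilon_i^j)^2=1$ for all $0\le i\le r$; explicitly $c_{m,n,h}=\frac{(m-h)!\,(r+1)}{h!\,(n-h)!\,(m+n-h+1)!}$. For $0\le j\le n$ define $T_j:P_r\to P_m$ linearly by $T_j(f_i^r)=\varepsilon_i^jf_{l_{ij}}^m$ if $j\in B(i)$ and $T_j(f_i^r)=0$ otherwise. The operators $T_0,\dots,T_n$ are Kraus operators (the EPOSIC Kraus operators) of a quantum channel $\Phi_{m,n,h}:End(P_r)\to End(P_m)$, $\Phi_{m,n,h}(A)=\sum_{j=0}^nT_jAT_j^*$, called the EPOSIC channel. *)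

theory Defs
  imports Jordan_Normal_Form.Schur_Decomposition
begin

text \<open>The space \<open>P\<^sub>k\<close> of homogeneous polynomials of degree \<open>k\<close> in \<open>x\<^sub>1, x\<^sub>2\<close> is represented by
  \<open>carrier_vec (k + 1)\<close>: a vector lists the coordinates of a polynomial in the orthonormal basis
  \<open>f\<^sub>l\<^sup>k = x\<^sub>1^l x\<^sub>2^(k - l) / sqrt (l! (k - l)!)\<close>, \<open>0 \<le> l \<le> k\<close>, and the inner product of \<open>P\<^sub>k\<close> becomes
  the standard one. Linear maps \<open>P\<^sub>k \<rightarrow> P\<^sub>l\<close> are \<open>(l + 1) \<times> (k + 1)\<close> matrices in these bases.\<close>

definition proj_onto :: "complex vec \<Rightarrow> complex mat" where
  "proj_onto w = mat (dim_vec w) (dim_vec w) (\<lambda>(a, b). w $ a * cnj (w $ b))"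

text \<open>Roots of the characteristic polynomial carry their multiplicity. For a state they are real,
  so that \<open>Re\<close> loses nothing, and \<open>x * log 2 x = 0\<close> at \<open>x = 0\<close>.\<close>

definition entropy :: "complex mat \<Rightarrow> real" where
  "entropy A = - (\<Sum>z\<in>#proots (char_poly A). Re z * log 2 (Re z))"

text \<open>Here \<open>d\<close> is the dimension of the input space. For a quantum channel the infimum is a minimum,
  the entropy being continuous and the unit sphere compact.\<close>

definition min_output_entropy :: "nat \<Rightarrow> (complex mat \<Rightarrow> complex mat) \<Rightarrow> real" where
  "min_output_entropy d \<Phi> =
     (INF w\<in>{w \<in> carrier_vec d. w \<bullet>c w = 1}. entropy (\<Phi> (proj_onto w)))"

text \<open>In the following definitions \<open>h \<le> m\<close> and \<open>h \<le> n\<close> are understood, and \<open>r = m + n - 2 * h\<close>.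
  Indices are natural numbers. A truncated difference \<open>a - b\<close> occurring as a lower bound of
  \<open>j\<close> or \<open>s\<close> stands for \<open>max 0 (a - b)\<close>. For \<open>j \<in> eposic_B m n h i\<close> and \<open>s\<close> in the range of the
  sum below, no other difference is truncated; \<open>l\<^sub>i\<^sub>j = i - j + h\<close> is written \<open>i + h - j\<close>,
  and \<open>i - j + s\<close> is written \<open>i + s - j\<close>.\<close>

definition eposic_B :: "nat \<Rightarrow> nat \<Rightarrow> nat \<Rightarrow> nat \<Rightarrow> nat set" where
  "eposic_B m n h i = {i + h - m .. min (i + h) n}"

definition eposic_c :: "nat \<Rightarrow> nat \<Rightarrow> nat \<Rightarrow> real" where
  "eposic_c m n h =
     fact (m - h) * real (m + n - 2 * h + 1) / (fact h * fact (n - h) * fact (m + n - h + 1))"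

definition eposic_coeff :: "nat \<Rightarrow> nat \<Rightarrow> nat \<Rightarrow> nat \<Rightarrow> nat \<Rightarrow> real" where
  "eposic_coeff m n h i j =
     (let r = m + n - 2 * h in
      \<Sum>s = max (j - i) (j + h - n) .. min h (min j (j + m - (i + h))).
        (- 1) ^ s
        * sqrt (eposic_c m n h * fact r * fact m * fact n
                / (real (r choose i) * real (m choose (i + h - j)) * real (n choose j)))
        * (real (h choose s) * real ((n - h) choose (j - s)) * real ((m - h) choose (i + s - j))
           / fact (m - h)))"

definition eposic_kraus :: "nat \<Rightarrow> nat \<Rightarrow> nat \<Rightarrow> nat \<Rightarrow> complex mat" where
  "eposic_kraus m n h j =
     mat (m + 1) (m + n - 2 * h + 1)
       (\<lambda>(l, i). if j \<in> eposic_B m n h i \<and> l = i + h - j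
                 then complex_of_real (eposic_coeff m n h i j) else 0)"

text \<open>The sum of the matrices \<open>T\<^sub>j * A * T\<^sub>j\<^sup>*\<close> is taken entrywise, because the type of matrices of
  all sizes is not an additive monoid.\<close>

definition eposic :: "nat \<Rightarrow> nat \<Rightarrow> nat \<Rightarrow> complex mat \<Rightarrow> complex mat" where
  "eposic m n h A =
     mat (m + 1) (m + 1)
       (\<lambda>(a, b). \<Sum>j\<le>n. (eposic_kraus m n h j * A * mat_adjoint (eposic_kraus m n h j)) $$ (a, b))"

end

theory Submission
  imports
    "HOL-Computational_Algebra.Formal_Power_Series"
    "HOL-Analysis.Function_Topology"
    "HOL-Analysis.Topology_Euclidean_Space"
    Defs
begin

unbundle no vec_syntax

text \<open>Write \<open>M w\<close> for the matrix with columns \<open>T\<^sub>0 w, \<dots>, T\<^sub>n w\<close>, so that the output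
  state is \<open>\<rho> = M w (M w)\<^sup>*\<close>. Since \<open>- x log\<^sub>2 x \<ge> x (1 - x)\<close> on \<open>[0, 1]\<close>, its entropy is at
  least \<open>1 - tr \<rho>\<^sup>2\<close>, which is half the sum of the squared \<open>2 \<times> 2\<close> minors of \<open>M w\<close>. This sum is
  continuous on the compact unit sphere, so the minimal output entropy is positive once no \<open>M w\<close> has
  rank one. Viewed as a bihomogeneous polynomial, \<open>M w\<close> lies in the copy of \<open>P\<^sub>r\<close> inside
  \<open>P\<^sub>m \<otimes> P\<^sub>n\<close>, all of whose elements are divisible by \<open>(x - y)^h\<close>. For \<open>h > 0\<close> it vanishes on the
  diagonal, whereas a product \<open>p(x) q(y)\<close> of nonzero polynomials does not. For \<open>h = 0\<close> the lowest
  weight vector is mapped to a product vector.\<close>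

section \<open>The weight vectors\<close>

text \<open>Without the case distinction a negative \<open>k\<close> would give
  \<open>n choose 0 = 1\<close>, and Pascal's rule would fail at \<open>k = 0\<close>.\<close>

definition ibinom :: "nat \<Rightarrow> int \<Rightarrow> real" where
  "ibinom n k = (if k < 0 then 0 else real (n choose nat k))"

lemma ibinom_Suc: "ibinom (Suc n) k = ibinom n k + ibinom n (k - 1)"
proof (cases "k \<le> 0")
  case True
  then show ?thesis by (cases "k = 0") (auto simp: ibinom_def)
next
  case False
  then have "nat k = Suc (nat (k - 1))" by simp
  then show ?thesis using False by (simp add: ibinom_def)
qed

lemma ibinom_0: "ibinom 0 k = (if k = 0 then 1 else 0)"
  by (auto simp: ibinom_def)

lemma ibinom_of_nat [simp]: "ibinom n (int k) = real (n choose k)"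
  by (simp add: ibinom_def)

lemma ibinom_eq_0: "k < 0 \<or> int n < k \<Longrightarrow> ibinom n k = 0"
  by (auto simp: ibinom_def)

lemma ibinom_pos: "0 \<le> k \<Longrightarrow> k \<le> int n \<Longrightarrow> ibinom n k > 0"
  by (auto simp: ibinom_def nat_le_iff)

lemma ibinom_absorb: "(int n - k + 1) * ibinom n (k - 1) = k * ibinom n k"
proof (induction n arbitrary: k)
  case 0
  then show ?case by (simp add: ibinom_0)
next
  case (Suc n)
  from Suc[of k] Suc[of "k - 1"] show ?case
    by (simp add: ibinom_Suc algebra_simps)
qed

text \<open>The coefficient of \<open>x^l y^j\<close> in \<open>(x - y)^h (1 + x)^a (1 + y)^b\<close>, where \<open>a = m - h\<close> and
  \<open>b = n - h\<close>; its part of degree \<open>h + i\<close> is, up to scaling, the image of the basis vector \<open>f\<^sub>i\<^sup>r\<close>.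
  Integer indices make all recurrences hold without boundary cases.\<close>

definition hw_coeff :: "nat \<Rightarrow> nat \<Rightarrow> nat \<Rightarrow> int \<Rightarrow> int \<Rightarrow> real" where
  "hw_coeff h a b l j =
     (\<Sum>s\<le>h. (-1) ^ s * real (h choose s) * (ibinom b (j - int s) * ibinom a (l - int h + int s)))"

lemma hw_coeff_0: "hw_coeff 0 0 0 l j = (if l = 0 \<and> j = 0 then 1 else 0)"
  by (simp add: hw_coeff_def ibinom_0)

text \<open>The three recurrences for \<open>hw_coeff\<close> express multiplication of the
  polynomial by \<open>1 + x\<close>, \<open>1 + y\<close> and \<open>x - y\<close>.\<close>

lemma hw_coeff_Suc_a: "hw_coeff h (Suc a) b l j = hw_coeff h a b l j + hw_coeff h a b (l - 1) j"
  unfolding hw_coeff_def sum.distrib[symmetric]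
  by (intro sum.cong) (auto simp: ibinom_Suc algebra_simps)

lemma hw_coeff_Suc_b: "hw_coeff h a (Suc b) l j = hw_coeff h a b l j + hw_coeff h a b l (j - 1)"
  unfolding hw_coeff_def sum.distrib[symmetric]
  by (intro sum.cong) (auto simp: ibinom_Suc algebra_simps)

text \<open>With the shift \<open>E f s = f (Suc s)\<close>, this is
  \<open>(1 - E)^(h + 1) = (1 - E)^h (1 - E)\<close> evaluated at \<open>0\<close>; Pascal's rule
  does the regrouping.\<close>

lemma alternating_binomial_sum_Suc:
  fixes f :: "nat \<Rightarrow> real"
  shows "(\<Sum>s\<le>Suc h. (-1) ^ s * real (Suc h choose s) * f s) =
    (\<Sum>s\<le>h. (-1) ^ s * real (h choose s) * (f s - f (Suc s)))"
proof -
  have "(\<Sum>s\<le>Suc h. (-1) ^ s * real (Suc h choose s) * f s) =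
      f 0 + (\<Sum>s\<le>h. - ((-1) ^ s * real (h choose s) * f (Suc s)))
      + (\<Sum>s\<le>h. (-1) ^ Suc s * real (h choose Suc s) * f (Suc s))"
    by (subst sum.atMost_Suc_shift) (simp add: sum.distrib[symmetric] algebra_simps)
  also have "\<dots> = (\<Sum>s\<le>h. - ((-1) ^ s * real (h choose s) * f (Suc s)))
      + (\<Sum>s\<le>Suc h. (-1) ^ s * real (h choose s) * f s)"
    by (subst sum.atMost_Suc_shift[of "\<lambda>s. (-1) ^ s * real (h choose s) * f s"]) simp
  also have "\<dots> = (\<Sum>s\<le>h. (-1) ^ s * real (h choose s) * (f s - f (Suc s)))"
    by (simp add: sum.distrib[symmetric] algebra_simps)
  finally show ?thesis .
qed

lemma hw_coeff_Suc_h: "hw_coeff (Suc h) a b l j = hw_coeff h a b (l - 1) j - hw_coeff h a b l (j - 1)"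
  unfolding hw_coeff_def alternating_binomial_sum_Suc sum_subtractf[symmetric]
  by (intro sum.cong) (auto simp: algebra_simps)

lemma hw_coeff_eq_0:
  assumes "l < 0 \<or> int (h + a) < l \<or> j < 0 \<or> int (h + b) < j"
  shows "hw_coeff h a b l j = 0"
  unfolding hw_coeff_def
proof (intro sum.neutral ballI)
  fix s assume "s \<in> {..h}"
  then have "ibinom b (j - int s) = 0 \<or> ibinom a (l - int h + int s) = 0"
    using assms by (auto intro!: ibinom_eq_0)
  then show "(-1) ^ s * real (h choose s) * (ibinom b (j - int s) * ibinom a (l - int h + int s)) = 0"
    by auto
qed

text \<open>The polynomial \<open>G\<close> above satisfies \<open>((1 + x) \<partial>\<^sub>x + (1 + y) \<partial>\<^sub>y) G = (h + a + b) G\<close>.\<close>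

lemma hw_coeff_lowering:
  "(l + 1) * hw_coeff h a b (l + 1) j + (j + 1) * hw_coeff h a b l (j + 1)
     = (int (h + a + b) - l - j) * hw_coeff h a b l j"
\<comment> \<open>The polynomial is built up factor by factor from \<open>1\<close>. The derivation
  maps each of \<open>1 + x\<close>, \<open>1 + y\<close>, \<open>x - y\<close> to itself, so its
  eigenvalue counts the factors.\<close>
proof (induction h arbitrary: l j)
  case 0
  show ?case
  proof (induction a arbitrary: l j)
    case 0
    show ?case
    proof (induction b arbitrary: l j)
      case 0
      then show ?case by (auto simp: hw_coeff_0)
    next
      case (Suc b)
      from Suc[of l j] Suc[of l "j - 1"] show ?case
        by (simp add: hw_coeff_Suc_b algebra_simps)
    qed
  next
    case (Suc a)
    from Suc[of l j] Suc[of "l - 1" j] show ?case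
      by (simp add: hw_coeff_Suc_a algebra_simps)
  qed
next
  case (Suc h)
  from Suc[of "l - 1" j] Suc[of l "j - 1"] show ?case
    by (simp add: hw_coeff_Suc_h algebra_simps)
qed

text \<open>Likewise \<open>(x (1 + x) \<partial>\<^sub>x + y (1 + y) \<partial>\<^sub>y) G = ((h + a) x + (h + b) y + h) G\<close>.\<close>

lemma hw_coeff_raising:
  "(int (h + a) - l + 1) * hw_coeff h a b (l - 1) j + (int (h + b) - j + 1) * hw_coeff h a b l (j - 1)
     = (l + j - int h) * hw_coeff h a b l j"
\<comment> \<open>This derivation multiplies the factors \<open>1 + x\<close>, \<open>1 + y\<close>,
  \<open>x - y\<close> by \<open>x\<close>, \<open>y\<close> and \<open>1 + x + y\<close>
  respectively.\<close>
proof (induction h arbitrary: l j)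
  case 0
  show ?case
  proof (induction a arbitrary: l j)
    case 0
    show ?case
    proof (induction b arbitrary: l j)
      case 0
      then show ?case by (auto simp: hw_coeff_0)
    next
      case (Suc b)
      from Suc[of l j] Suc[of l "j - 1"] show ?case
        by (simp add: hw_coeff_Suc_b algebra_simps)
    qed
  next
    case (Suc a)
    from Suc[of l j] Suc[of "l - 1" j] show ?case
      by (simp add: hw_coeff_Suc_a algebra_simps)
  qed
next
  case (Suc h)
  from Suc[of "l - 1" j] Suc[of l "j - 1"] show ?case
    by (simp add: hw_coeff_Suc_h algebra_simps)
qed

text \<open>The sum is the coefficient of degree \<open>k\<close> after setting
  \<open>x = y\<close>, where the factor \<open>x - y\<close> vanishes. Splitting off one such
  factor makes the sum telescope.\<close>

lemma sum_hw_coeff_antidiagonal: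
  assumes "h > 0"
  shows "(\<Sum>j\<le>h + b. hw_coeff h a b (k - int j) (int j)) = 0"
proof -
  obtain g where h: "h = Suc g" using assms gr0_conv_Suc by auto
  define u where "u j = hw_coeff g a b (k - j) (j - 1)" for j :: int
  have "(\<Sum>j\<le>h + b. hw_coeff h a b (k - int j) (int j)) = (\<Sum>j<Suc (h + b). u (int (Suc j)) - u (int j))"
    unfolding lessThan_Suc_atMost
    by (intro sum.cong) (auto simp: h hw_coeff_Suc_h u_def algebra_simps)
  also have "\<dots> = u (int (Suc (h + b))) - u (int 0)"
    by (rule sum_lessThan_telescope)
  also have "\<dots> = 0"
    unfolding u_def by (simp add: hw_coeff_eq_0 h)
  finally show ?thesis .
qed

text \<open>In \<open>P\<^sub>m\<close> the monomial \<open>x^l\<close> has squared norm \<open>1 / (m choose l)\<close>, up to a factor depending only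
  on \<open>m\<close>. Terms with index out of range vanish, because the numerator does.\<close>

definition hw_norm :: "nat \<Rightarrow> nat \<Rightarrow> nat \<Rightarrow> int \<Rightarrow> real" where
  "hw_norm h a b k =
     (\<Sum>j\<le>h + b. (hw_coeff h a b (k - int j) (int j))\<^sup>2 / (ibinom (h + a) (k - int j) * ibinom (h + b) (int j)))"

text \<open>The raising and lowering operators are adjoint to each other.\<close>

lemma hw_norm_rec:
  "(k - int h) * hw_norm h a b k = (int (h + a + b) - k + 1) * hw_norm h a b (k - 1)"
proof -
  let ?m = "h + a" and ?n = "h + b" and ?g = "hw_coeff h a b"
  \<comment> \<open>Both sides are the inner product of the part of degree \<open>k\<close> with the
    raised part of degree \<open>k - 1\<close>. \<open>?v\<close> collects the contributions of
    raising in \<open>x\<close>, \<open>X\<close> those of raising in \<open>y\<close>; lowering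
    yields the latter with \<open>j\<close> shifted by one.\<close>
  let ?v = "\<lambda>j::nat. (int ?m - (k - int j) + 1) * (?g (k - int j) (int j) * ?g (k - int j - 1) (int j))
                    / (ibinom ?m (k - int j) * ibinom ?n (int j))"
  define X where "X j = (int ?n - j + 1) * (?g (k - j) j * ?g (k - j) (j - 1))
                    / (ibinom ?m (k - j) * ibinom ?n j)" for j
  have "(k - int h) * hw_norm h a b k = (\<Sum>j\<le>?n. ?v j + X (int j))"
    unfolding hw_norm_def sum_distrib_left
  proof (intro sum.cong refl)
    fix j
    have "(k - int h) * ((?g (k - int j) (int j))\<^sup>2 / (ibinom ?m (k - int j) * ibinom ?n (int j)))
      = ?g (k - int j) (int j) * ((k - int j + int j - int h) * ?g (k - int j) (int j))
         / (ibinom ?m (k - int j) * ibinom ?n (int j))"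
      by (simp add: power2_eq_square)
    also have "\<dots> = ?v j + X (int j)"
      unfolding hw_coeff_raising[symmetric] X_def by (simp add: add_divide_distrib distrib_left mult_ac)
    finally show "(k - int h) * ((?g (k - int j) (int j))\<^sup>2 / (ibinom ?m (k - int j) * ibinom ?n (int j)))
      = ?v j + X (int j)" .
  qed
  moreover have "(int (h + a + b) - k + 1) * hw_norm h a b (k - 1) = (\<Sum>j\<le>?n. ?v j + X (int (Suc j)))"
    unfolding hw_norm_def sum_distrib_left
  proof (intro sum.cong refl)
    fix j assume "j \<in> {..?n}"
    then have j: "j \<le> ?n" by simp
    define l where "l = k - int j"
    have "(int (h + a + b) - k + 1) * ((?g (k - 1 - int j) (int j))\<^sup>2 / (ibinom ?m (k - 1 - int j) * ibinom ?n (int j)))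
      = ?g (l - 1) (int j) * ((int (h + a + b) - (l - 1) - int j) * ?g (l - 1) (int j))
         / (ibinom ?m (l - 1) * ibinom ?n (int j))"
      by (simp add: power2_eq_square l_def algebra_simps)
    also have "\<dots> = l * (?g (l - 1) (int j) * ?g l (int j)) / (ibinom ?m (l - 1) * ibinom ?n (int j))
       + (int j + 1) * (?g (l - 1) (int j) * ?g (l - 1) (int j + 1)) / (ibinom ?m (l - 1) * ibinom ?n (int j))"
      unfolding hw_coeff_lowering[symmetric] by (simp add: add_divide_distrib distrib_left mult_ac)
    also have "l * (?g (l - 1) (int j) * ?g l (int j)) / (ibinom ?m (l - 1) * ibinom ?n (int j)) = ?v j"
    proof (cases "1 \<le> l \<and> l \<le> int ?m")
      case True
      then have "l / ibinom ?m (l - 1) = (int ?m - l + 1) / ibinom ?m l"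
        using ibinom_absorb[of ?m l] ibinom_pos[of l ?m] ibinom_pos[of "l - 1" ?m]
        by (simp add: frac_eq_eq)
      then have "l / ibinom ?m (l - 1) * (?g (l - 1) (int j) * ?g l (int j)) / ibinom ?n (int j)
          = (int ?m - l + 1) / ibinom ?m l * (?g (l - 1) (int j) * ?g l (int j)) / ibinom ?n (int j)"
        by simp
      then show ?thesis by (simp add: l_def mult_ac)
    next
      case False
      then have "?g (l - 1) (int j) * ?g l (int j) = 0"
        by (auto simp: hw_coeff_eq_0)
      then show ?thesis by (auto simp: l_def)
    qed
    also have "(int j + 1) * (?g (l - 1) (int j) * ?g (l - 1) (int j + 1)) / (ibinom ?m (l - 1) * ibinom ?n (int j))
        = X (int (Suc j))"
    proof (cases "j < ?n")
      case True
      then have "(int j + 1) / ibinom ?n (int j) = (int ?n - int (Suc j) + 1) / ibinom ?n (int (Suc j))"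
        using ibinom_absorb[of ?n "int j + 1"] ibinom_pos[of "int j" ?n] ibinom_pos[of "int (Suc j)" ?n]
        by (simp add: frac_eq_eq add.commute)
      then have "(int j + 1) / ibinom ?n (int j) * (?g (l - 1) (int j) * ?g (l - 1) (int j + 1)) / ibinom ?m (l - 1)
         = (int ?n - int (Suc j) + 1) / ibinom ?n (int (Suc j)) * (?g (l - 1) (int j) * ?g (l - 1) (int j + 1)) / ibinom ?m (l - 1)"
        by simp
      moreover have "X (int (Suc j)) = (int ?n - int (Suc j) + 1)
          * (?g (l - 1) (int j + 1) * ?g (l - 1) (int j)) / (ibinom ?m (l - 1) * ibinom ?n (int (Suc j)))"
        by (simp add: X_def l_def algebra_simps)
      ultimately show ?thesis by (simp add: mult_ac)
    next
      case False
      then have "?g (l - 1) (int j + 1) = 0" by (intro hw_coeff_eq_0) auto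
      moreover have "?g (k - int (Suc j)) (int (Suc j)) = 0"
        using False by (intro hw_coeff_eq_0) auto
      ultimately show ?thesis unfolding X_def by simp
    qed
    finally show "(int (h + a + b) - k + 1) * ((?g (k - 1 - int j) (int j))\<^sup>2 / (ibinom ?m (k - 1 - int j) * ibinom ?n (int j)))
      = ?v j + X (int (Suc j))" .
  qed
  \<comment> \<open>The shift costs nothing, since \<open>X\<close> vanishes at \<open>0\<close> and
    at \<open>?n + 1\<close>.\<close>
  moreover have "(\<Sum>j\<le>?n. X (int j)) = (\<Sum>j\<le>?n. X (int (Suc j)))"
  proof -
    have "(\<Sum>j\<le>Suc ?n. X (int j)) = X (int 0) + (\<Sum>j\<le>?n. X (int (Suc j)))"
      by (rule sum.atMost_Suc_shift)
    moreover have "X (int 0) = 0" "X (int (Suc ?n)) = 0"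
      unfolding X_def by (simp_all add: hw_coeff_eq_0)
    ultimately show ?thesis by simp
  qed
  ultimately show ?thesis by (simp add: sum.distrib)
qed

text \<open>The recurrence \<open>hw_norm_rec\<close> is that of the binomial coefficients. The
  factor obtained here later cancels the \<open>r choose i\<close> in the denominator of the EPOSIC
  coefficients.\<close>

lemma hw_norm_binomial:
  assumes "i \<le> a + b"
  shows "hw_norm h a b (int (h + i)) = real ((a + b) choose i) * hw_norm h a b (int h)"
  using assms
proof (induction i)
  case (Suc i)
  let ?r = "a + b"
  have "real (Suc i) * hw_norm h a b (int (h + Suc i)) = (real ?r - real i) * hw_norm h a b (int (h + i))"
    using hw_norm_rec[of "int (h + Suc i)" h a b] by (simp add: algebra_simps)
  also have "\<dots> = ((real ?r - real i) * real (?r choose i)) * hw_norm h a b (int h)"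
    using Suc by simp
  also have "(real ?r - real i) * real (?r choose i) = real (Suc i) * real (?r choose Suc i)"
  proof -
    have "int (Suc i) - 1 = int i" by simp
    then show ?thesis
      using ibinom_absorb[of ?r "int (Suc i)"] by (simp del: of_nat_Suc) (simp add: add_diff_eq)
  qed
  finally show ?case by simp
qed simp

text \<open>Vandermonde's convolution for the negative upper indices \<open>-(a + 1)\<close> and
  \<open>-(b + 1)\<close>; the signs combine to \<open>(-1)^h\<close> on both sides.\<close>

lemma sum_binomial_negative_Vandermonde:
  "(\<Sum>j\<le>h. ((a + j) choose j) * ((b + (h - j)) choose (h - j))) = (a + b + h + 1) choose h"
proof -
  have neg: "(- (real c + 1)) gchoose j = (-1) ^ j * real ((c + j) choose j)" for c j
    unfolding gbinomial_minus by (simp add: binomial_gbinomial add_ac)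
  have "(-1) ^ h * (\<Sum>j\<le>h. real ((a + j) choose j) * real ((b + (h - j)) choose (h - j)))
      = (\<Sum>j\<le>h. ((- (real a + 1)) gchoose j) * ((- (real b + 1)) gchoose (h - j)))"
    unfolding neg sum_distrib_left
  proof (intro sum.cong refl)
    fix j assume "j \<in> {..h}"
    then have "(-1 :: real) ^ h = (-1) ^ j * (-1) ^ (h - j)"
      by (simp flip: power_add)
    then show "(-1) ^ h * (real ((a + j) choose j) * real ((b + (h - j)) choose (h - j))) =
      (-1) ^ j * real ((a + j) choose j) * ((-1) ^ (h - j) * real ((b + (h - j)) choose (h - j)))"
      by simp
  qed
  also have "\<dots> = (- (real a + 1) + - (real b + 1)) gchoose h"
    by (simp only: gbinomial_Vandermonde atMost_atLeast0)
  also have "- (real a + 1) + - (real b + 1) = - (real (a + b + 1) + 1)"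
    by simp
  also have "(- (real (a + b + 1) + 1)) gchoose h = (-1) ^ h * real ((a + b + h + 1) choose h)"
    unfolding neg by (simp add: add_ac)
  finally have "(\<Sum>j\<le>h. real ((a + j) choose j) * real ((b + (h - j)) choose (h - j)))
      = real ((a + b + h + 1) choose h)"
    by simp
  then show ?thesis
    by (simp only: of_nat_mult[symmetric] of_nat_sum[symmetric] of_nat_eq_iff)
qed

text \<open>In the lowest degree \<open>h\<close> only the constant terms of
  \<open>(1 + x)^a\<close> and \<open>(1 + y)^b\<close> meet \<open>(x - y)^h\<close>.\<close>

lemma hw_coeff_lowest_weight:
  assumes "j \<le> h"
  shows "hw_coeff h a b (int h - int j) (int j) = (-1) ^ j * real (h choose j)"
proof -
  have "hw_coeff h a b (int h - int j) (int j)
    = (\<Sum>s\<le>h. if s = j then (-1) ^ s * real (h choose s) else 0)"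
    unfolding hw_coeff_def
    by (intro sum.cong) (auto simp: ibinom_def)
  then show ?thesis using assms by simp
qed

lemma hw_norm_lowest_weight:
  "hw_norm h a b (int h) =
     fact h * fact a * fact b * fact (h + a + b + 1) / (fact (h + a) * fact (h + b) * fact (a + b + 1))"
proof -
  \<comment> \<open>Writing \<open>(h choose j)^2\<close> over the two binomials in factorials,
    \<open>?C\<close> is the part independent of \<open>j\<close>; the rest is a summand of the
    preceding Vandermonde sum.\<close>
  let ?C = "fact h * fact a * fact b * fact h / (fact (h + a) * fact (h + b)) :: real"
  have "hw_norm h a b (int h) = (\<Sum>j\<le>h. ?C * real (((a + j) choose j) * ((b + (h - j)) choose (h - j))))"
    unfolding hw_norm_def
  proof (intro sum.mono_neutral_cong_right ballI)
    fix j assume "j \<in> {..h + b} - {..h}"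
    then show "(hw_coeff h a b (int h - int j) (int j))\<^sup>2 /
         (ibinom (h + a) (int h - int j) * ibinom (h + b) (int j)) = 0"
      by (simp add: hw_coeff_eq_0)
  next
    fix j assume "j \<in> {..h}"
    then have j: "j \<le> h" by simp
    then have hj: "int h - int j = int (h - j)" by simp
    show "(hw_coeff h a b (int h - int j) (int j))\<^sup>2 /
         (ibinom (h + a) (int h - int j) * ibinom (h + b) (int j)) =
       ?C * real (((a + j) choose j) * ((b + (h - j)) choose (h - j)))"
      unfolding hw_coeff_lowest_weight[OF j]
      unfolding hj ibinom_of_nat using j
      by (simp add: binomial_fact power_mult_distrib power2_eq_square field_simps)
  qed auto
  also have "\<dots> = ?C * real ((a + b + h + 1) choose h)"
    by (simp only: sum_distrib_left[symmetric] of_nat_sum[symmetric] sum_binomial_negative_Vandermonde)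
  also have "\<dots> = fact h * fact a * fact b * fact (h + a + b + 1) / (fact (h + a) * fact (h + b) * fact (a + b + 1))"
    by (simp add: binomial_fact add_ac mult_ac)
  finally show ?thesis .
qed

section \<open>Entropy and purity\<close>

definition mtrace :: "'a :: comm_ring_1 mat \<Rightarrow> 'a" where
  "mtrace A = (\<Sum>i<dim_row A. A $$ (i, i))"

lemma mtrace_mult:
  assumes "A \<in> carrier_mat n m" "B \<in> carrier_mat m n"
  shows "mtrace (A * B) = (\<Sum>i<n. \<Sum>j<m. A $$ (i, j) * B $$ (j, i))"
  using assms by (auto simp: mtrace_def scalar_prod_def atLeast0LessThan intro!: sum.cong)

lemma mtrace_comm:
  assumes "A \<in> carrier_mat n m" "B \<in> carrier_mat m n"
  shows "mtrace (A * B) = mtrace (B * A)"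
  unfolding mtrace_mult[OF assms] mtrace_mult[OF assms(2,1)]
  by (subst sum.swap) (simp add: mult.commute)

lemma mtrace_conjugate:
  assumes "{B, P, Q} \<subseteq> carrier_mat n n" "Q * P = 1\<^sub>m n"
  shows "mtrace (P * B * Q) = mtrace B"
proof -
  have "mtrace (P * B * Q) = mtrace (Q * (P * B))"
    using assms by (intro mtrace_comm[of _ n n]) auto
  also have "Q * (P * B) = B"
    using assms by (simp add: left_mult_one_mat[of _ n n] flip: assoc_mult_mat[of Q n n P n B n])
  finally show ?thesis .
qed

lemma mtrace_square_upper_triangular:
  assumes "B \<in> carrier_mat n n" "upper_triangular B"
  shows "mtrace (B * B) = (\<Sum>i<n. (B $$ (i, i))\<^sup>2)"
proof -
  have "(\<Sum>j<n. B $$ (i, j) * B $$ (j, i)) = (B $$ (i, i))\<^sup>2" if i: "i < n" for i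
  proof -
    have "B $$ (i, j) * B $$ (j, i) = 0" if "j < n" "j \<noteq> i" for j
      using assms that i by (cases "j < i") (auto simp: upper_triangular_def)
    then have "(\<Sum>j<n. B $$ (i, j) * B $$ (j, i)) = (\<Sum>j\<in>{i}. B $$ (i, j) * B $$ (j, i))"
      using i by (intro sum.mono_neutral_right) auto
    then show ?thesis by (simp add: power2_eq_square)
  qed
  then show ?thesis using assms(1) by (simp add: mtrace_mult)
qed

lemma proots_prod_linear_factors:
  "proots (\<Prod>a\<leftarrow>es. [:- a, 1:]) = mset (es :: 'a :: idom list)"
  by (induction es) (simp_all add: proots_mult prod_list_zero_iff image_iff del: mult_pCons_left)

text \<open>By Schur decomposition \<open>A\<close> is similar to an upper triangular
  \<open>B\<close>, whose diagonal lists the roots with multiplicity. Both traces are invariant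
  under similarity.\<close>

lemma mtrace_proots_char_poly:
  fixes A :: "complex mat"
  assumes A: "A \<in> carrier_mat n n"
  shows "(\<Sum>z\<in>#proots (char_poly A). z) = mtrace A"
    and "(\<Sum>z\<in>#proots (char_poly A). z\<^sup>2) = mtrace (A * A)"
proof -
  obtain es where "char_poly A = (\<Prod>a\<leftarrow>es. [:- a, 1:])"
    using char_poly_factorized[OF A] by auto
  from schur_decomposition_exists[OF A this]
  obtain B where B: "B \<in> carrier_mat n n" "upper_triangular B" and sim: "similar_mat A B"
    by auto
  from similar_matD[OF sim] obtain k P Q where
    *: "{A, B, P, Q} \<subseteq> carrier_mat k k" "Q * P = 1\<^sub>m k" "A = P * B * Q" by auto
  with A have k: "k = n" by auto
  note * = *[unfolded k]
  have "char_poly A = (\<Prod>a\<leftarrow>diag_mat B. [:- a, 1:])"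
    using char_poly_similar[OF sim] char_poly_upper_triangular[OF B] by simp
  then have roots: "proots (char_poly A) = mset (diag_mat B)"
    by (simp add: proots_prod_linear_factors)
  have diag: "sum_list (map f (diag_mat B)) = (\<Sum>i<n. f (B $$ (i, i)))" for f :: "complex \<Rightarrow> complex"
    using B by (simp add: diag_mat_def sum_list_sum_nth atLeast0LessThan)
  show "(\<Sum>z\<in>#proots (char_poly A). z) = mtrace A"
  proof -
    have "mtrace A = mtrace B"
      unfolding *(3) by (rule mtrace_conjugate[of B P Q n]) (use *(1,2) in auto)
    then show ?thesis
      using diag[of "\<lambda>z. z"] B(1)
      by (simp add: roots mtrace_def sum_mset_sum_list)
  qed
  have "A * A = P * (B * B) * Q"
  proof -
    have B: "B \<in> carrier_mat n n" and P: "P \<in> carrier_mat n n" and Q: "Q \<in> carrier_mat n n"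
      using * by auto
    note assoc = assoc_mult_mat[where n\<^sub>1 = n and n\<^sub>2 = n and n\<^sub>3 = n and n\<^sub>4 = n]
    have "A * A = P * B * (Q * (P * B * Q))"
      unfolding *(3) using B P Q by (intro assoc) auto
    also have "Q * (P * B * Q) = Q * (P * (B * Q))"
      using assoc[OF P B Q] by simp
    also have "\<dots> = Q * P * (B * Q)"
      using B P Q by (intro assoc[symmetric]) auto
    also have "\<dots> = B * Q"
      unfolding *(2) using B Q by (intro left_mult_one_mat) auto
    also have "P * B * (B * Q) = P * B * B * Q"
      using B P Q by (intro assoc[symmetric]) auto
    also have "P * B * B = P * (B * B)"
      using B P Q by (intro assoc) auto
    finally show ?thesis .
  qed
  then have "mtrace (A * A) = mtrace (B * B)"
    using mtrace_conjugate[of "B * B" P Q n] *(1,2) mult_carrier_mat[of B n n B n] by simp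
  then show "(\<Sum>z\<in>#proots (char_poly A). z\<^sup>2) = mtrace (A * A)"
    using diag[of "\<lambda>z. z\<^sup>2"] mtrace_square_upper_triangular[OF B]
    by (simp only: roots sum_mset_sum_list mset_map[symmetric])
qed

text \<open>For an eigenvector \<open>v\<close> of \<open>M M*\<close>, pairing with
  \<open>v\<close> gives \<open>z |v|^2 = |M* v|^2\<close>.\<close>

lemma eigenvalue_gram_nonneg:
  fixes M :: "nat \<Rightarrow> nat \<Rightarrow> complex"
  assumes ev: "eigenvalue (mat n n (\<lambda>(a, b). \<Sum>j\<in>J. M a j * cnj (M b j))) z"
  shows "z \<in> \<real> \<and> Re z \<ge> 0"
proof -
  let ?A = "mat n n (\<lambda>(a, b). \<Sum>j\<in>J. M a j * cnj (M b j))"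
  from ev obtain v where v: "v \<in> carrier_vec n" "v \<noteq> 0\<^sub>v n" and e: "?A *\<^sub>v v = z \<cdot>\<^sub>v v"
    by (auto simp: eigenvalue_def eigenvector_def)
  define s where "s = (\<Sum>a<n. (cmod (v $ a))\<^sup>2)"
  define t where "t = (\<Sum>j\<in>J. (cmod (\<Sum>b<n. cnj (M b j) * v $ b))\<^sup>2)"
  have "z * complex_of_real s = (\<Sum>a<n. cnj (v $ a) * (z \<cdot>\<^sub>v v) $ a)"
    using v by (simp add: s_def complex_norm_square sum_distrib_left mult_ac del: of_real_power)
  also have "\<dots> = (\<Sum>a<n. \<Sum>b<n. \<Sum>j\<in>J. cnj (v $ a) * M a j * cnj (M b j) * v $ b)"
    unfolding e[symmetric] using v
    by (auto simp: scalar_prod_def atLeast0LessThan sum_distrib_left sum_distrib_right mult_ac intro!: sum.cong)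
  also have "\<dots> = (\<Sum>a<n. \<Sum>j\<in>J. \<Sum>b<n. cnj (v $ a) * M a j * cnj (M b j) * v $ b)"
    by (intro sum.cong refl sum.swap)
  also have "\<dots> = (\<Sum>j\<in>J. \<Sum>a<n. \<Sum>b<n. cnj (v $ a) * M a j * cnj (M b j) * v $ b)"
    by (rule sum.swap)
  also have "\<dots> = (\<Sum>j\<in>J. (\<Sum>a<n. M a j * cnj (v $ a)) * (\<Sum>b<n. cnj (M b j) * v $ b))"
    by (simp add: sum_product mult_ac)
  also have "\<dots> = complex_of_real t"
    unfolding t_def of_real_sum complex_norm_square cnj_sum by (simp add: mult.commute)
  finally have zs: "z * complex_of_real s = complex_of_real t" .
  obtain a where "a < n" "v $ a \<noteq> 0"
    using v by (metis carrier_vecD eq_vecI index_zero_vec)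
  then have "s > 0" unfolding s_def by (intro sum_pos2[of _ a]) auto
  then have "z = complex_of_real (t / s)" using zs by (simp add: field_simps)
  moreover have "t \<ge> 0" unfolding t_def by (intro sum_nonneg) auto
  ultimately show ?thesis using \<open>s > 0\<close> by auto
qed

text \<open>On \<open>(0, 1]\<close>, \<open>log 2 x <= ln x <= x - 1\<close>: the first because
  \<open>ln x <= 0\<close> and \<open>ln 2 <= 1\<close>. Multiply by \<open>-x\<close>.\<close>

lemma neg_mult_log2_ge:
  assumes "0 \<le> x" "x \<le> 1"
  shows "x * (1 - x) \<le> - (x * log 2 x)"
proof (cases "x = 0")
  case False
  with assms have x: "x > 0" by simp
  have "ln x \<le> x - 1" using x by (rule ln_le_minus_one)
  moreover have "log 2 x \<le> ln x"
  proof -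
    have "ln 2 \<le> (1::real)" using ln_le_minus_one[of "2::real"] by simp
    moreover have "ln x \<le> 0" using assms x by simp
    ultimately have "ln x \<le> ln x * ln 2"
      using mult_left_mono_neg[of "ln 2" 1 "ln x"] by simp
    then show ?thesis by (simp add: log_def pos_divide_le_eq)
  qed
  ultimately have "1 - x \<le> - log 2 x" by simp
  from mult_left_mono[OF this, of x] x show ?thesis by simp
qed simp

lemma sum_mset_nonneg_real:
  fixes f :: "'a \<Rightarrow> real"
  assumes "\<And>x. x \<in># S \<Longrightarrow> 0 \<le> f x"
  shows "0 \<le> (\<Sum>x\<in>#S. f x)"
  using assms by (induction S) auto

text \<open>The eigenvalues form a probability distribution, so the pointwise bound can be summed
  over them. If the purity is \<open>1\<close>, the nonnegative terms \<open>x (1 - x)\<close> sum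
  to zero, hence every eigenvalue is \<open>0\<close> or \<open>1\<close> and contributes no
  entropy.\<close>

lemma
  fixes M :: "nat \<Rightarrow> nat \<Rightarrow> complex" and J :: "nat set" and n :: nat
  defines "A \<equiv> mat n n (\<lambda>(a, b). \<Sum>j\<in>J. M a j * cnj (M b j))"
  assumes tr: "mtrace A = 1"
  shows entropy_ge_linear_entropy: "1 - Re (mtrace (A * A)) \<le> entropy A"
    and entropy_eq_0: "mtrace (A * A) = 1 \<Longrightarrow> entropy A = 0"
proof -
  have A: "A \<in> carrier_mat n n" by (simp add: A_def)
  let ?R = "proots (char_poly A)"
  have "char_poly A \<noteq> 0" using degree_monic_char_poly[OF A] by auto
  then have R: "z = complex_of_real (Re z) \<and> Re z \<ge> 0" if z: "z \<in># ?R" for z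
    using that eigenvalue_root_char_poly[OF A, of z] eigenvalue_gram_nonneg[of n M J z]
    by (simp add: A_def)
  have s1: "(\<Sum>z\<in>#?R. Re z) = 1"
  proof -
    have "Re (\<Sum>z\<in>#S. z) = (\<Sum>z\<in>#S. Re z)" for S
      by (induction S) auto
    from this[of ?R] show ?thesis unfolding mtrace_proots_char_poly(1)[OF A] tr by simp
  qed
  have le1: "Re z \<le> 1" if z: "z \<in># ?R" for z
  proof -
    obtain S where S: "?R = add_mset z S" using multi_member_split[OF z] by auto
    have "(\<Sum>z\<in>#S. Re z) \<ge> 0" using R S by (intro sum_mset_nonneg_real) auto
    then show ?thesis using s1 S by simp
  qed
  have s2: "(\<Sum>z\<in>#?R. (Re z)\<^sup>2) = Re (mtrace (A * A))"
  proof -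
    have "(\<Sum>z\<in>#?R. z\<^sup>2) = (\<Sum>z\<in>#?R. complex_of_real ((Re z)\<^sup>2))"
    proof (intro arg_cong[of _ _ sum_mset] image_mset_cong)
      fix z assume "z \<in># ?R"
      from R[OF this] have "z = complex_of_real (Re z)" ..
      then have "z\<^sup>2 = (complex_of_real (Re z))\<^sup>2" by (rule arg_cong)
      then show "z\<^sup>2 = complex_of_real ((Re z)\<^sup>2)" by simp
    qed
    moreover have "Re (\<Sum>z\<in>#S. complex_of_real ((Re z)\<^sup>2)) = (\<Sum>z\<in>#S. (Re z)\<^sup>2)" for S
      by (induction S) auto
    ultimately show ?thesis by (simp only: mtrace_proots_char_poly(2)[OF A, symmetric])
  qed
  have diff: "(\<Sum>z\<in>#S. Re z * (1 - Re z)) = (\<Sum>z\<in>#S. Re z) - (\<Sum>z\<in>#S. (Re z)\<^sup>2)" for S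
    by (induction S) (auto simp: power2_eq_square algebra_simps)
  have ent: "entropy A = (\<Sum>z\<in>#?R. - (Re z * log 2 (Re z)))"
  proof -
    have "- (\<Sum>z\<in>#S. f z) = (\<Sum>z\<in>#S. - f z)" for S and f :: "complex \<Rightarrow> real"
      by (induction S) auto
    then show ?thesis unfolding entropy_def .
  qed
  have "(\<Sum>z\<in>#?R. Re z * (1 - Re z)) \<le> entropy A"
    unfolding ent by (intro sum_mset_mono neg_mult_log2_ge) (use R le1 in auto)
  then show "1 - Re (mtrace (A * A)) \<le> entropy A"
    unfolding diff s1 s2 .
  assume "mtrace (A * A) = 1"
  then have z0: "(\<Sum>z\<in>#?R. Re z * (1 - Re z)) = 0" unfolding diff s1 s2 by simp
  have "Re z * (1 - Re z) = 0" if z: "z \<in># ?R" for z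
  proof -
    obtain S where S: "?R = add_mset z S" using multi_member_split[OF z] by auto
    have "(\<Sum>z\<in>#S. Re z * (1 - Re z)) \<ge> 0" using R le1 S by (intro sum_mset_nonneg_real) auto
    moreover have "Re z * (1 - Re z) \<ge> 0" using R le1 that by simp
    moreover have "Re z * (1 - Re z) + (\<Sum>z\<in>#S. Re z * (1 - Re z)) = 0"
      using z0 by (simp only: S image_mset_add_mset sum_mset.add_mset)
    ultimately show ?thesis by linarith
  qed
  then have "Re z * log 2 (Re z) = 0" if "z \<in># ?R" for z using that by fastforce
  then have "image_mset (\<lambda>z. Re z * log 2 (Re z)) ?R = image_mset (\<lambda>z. 0) ?R"
    by (intro image_mset_cong) auto
  then show "entropy A = 0" unfolding entropy_def by simp
qed

text \<open>Vectors are encoded as functions on \<open>nat\<close> vanishing from \<open>d\<close>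
  on, which carry the product topology. The sphere is a closed subset of a product of discs and
  points, compact by Tychonoff's theorem.\<close>

lemma continuous_attains_inf_unit_sphere:
  fixes f :: "(nat \<Rightarrow> complex) \<Rightarrow> real" and d :: nat
  defines "S \<equiv> {w. (\<forall>i\<ge>d. w i = 0) \<and> (\<Sum>i<d. (cmod (w i))\<^sup>2) = 1}"
  assumes "d > 0" and f: "continuous_on UNIV f"
  shows "\<exists>w\<in>S. \<forall>v\<in>S. f w \<le> f v"
proof (intro continuous_attains_inf)
  let ?B = "\<lambda>i. if i < d then cball 0 1 else {0} :: complex set"
  have "compactin (product_topology (\<lambda>_. euclidean) UNIV) (PiE UNIV ?B)"
    by (simp add: compactin_PiE)
  then have "compact (PiE UNIV ?B)"
    by (simp add: euclidean_product_topology)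
  moreover have "closed {w :: nat \<Rightarrow> complex. (\<Sum>i<d. (cmod (w i))\<^sup>2) = 1}"
    by (intro closed_Collect_eq continuous_intros continuous_on_product_coordinates)
  moreover have "S = PiE UNIV ?B \<inter> {w. (\<Sum>i<d. (cmod (w i))\<^sup>2) = 1}"
  proof -
    have "cmod (w i) \<le> 1" if "(\<Sum>i<d. (cmod (w i))\<^sup>2) = 1" "i < d" for w :: "nat \<Rightarrow> complex" and i
    proof -
      have "(cmod (w i))\<^sup>2 \<le> (\<Sum>i<d. (cmod (w i))\<^sup>2)"
        using that(2) by (intro member_le_sum) auto
      then show ?thesis using that(1) by (simp add: abs_square_le_1)
    qed
    then show ?thesis unfolding S_def by (fastforce simp: PiE_def Pi_def split: if_splits)
  qed
  ultimately show "compact S" by (simp add: compact_Int_closed)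
  have "(\<lambda>i. if i = 0 then 1 else 0) \<in> S"
    using \<open>d > 0\<close> by (simp add: S_def if_distrib[of cmod] if_distrib[of "\<lambda>x. x\<^sup>2"] cong: if_cong)
  then show "S \<noteq> {}" by blast
  show "continuous_on S f" using f by (rule continuous_on_subset) simp
qed

section \<open>Purity and minors\<close>

definition sum_minors :: "nat \<Rightarrow> nat \<Rightarrow> (nat \<Rightarrow> nat \<Rightarrow> complex) \<Rightarrow> real" where
  "sum_minors m n M = (\<Sum>a\<le>m. \<Sum>b\<le>m. \<Sum>j\<le>n. \<Sum>k\<le>n. (cmod (M a j * M b k - M a k * M b j))\<^sup>2)"

lemma sum_minors_nonneg: "sum_minors m n M \<ge> 0"
  unfolding sum_minors_def by (intro sum_nonneg) auto

lemma sum_minors_eq_0D: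
  assumes "sum_minors m n M = 0" "a \<le> m" "b \<le> m" "j \<le> n" "k \<le> n"
  shows "M a j * M b k = M a k * M b j"
proof -
  have "(cmod (M a j * M b k - M a k * M b j))\<^sup>2 = 0"
    using assms unfolding sum_minors_def
    by (simp add: sum_nonneg_eq_0_iff sum_nonneg)
  then show ?thesis by simp
qed

definition gram :: "nat \<Rightarrow> nat \<Rightarrow> (nat \<Rightarrow> nat \<Rightarrow> complex) \<Rightarrow> complex mat" where
  "gram m n M = mat (m + 1) (m + 1) (\<lambda>(a, b). \<Sum>j\<le>n. M a j * cnj (M b j))"

lemma mtrace_gram: "mtrace (gram m n M) = complex_of_real (\<Sum>a\<le>m. \<Sum>j\<le>n. (cmod (M a j))\<^sup>2)"
  unfolding of_real_sum complex_norm_square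
  by (simp add: mtrace_def gram_def lessThan_Suc_atMost)

text \<open>Lagrange's identity: expanding the squared minors gives the squared trace twice, minus
  the purity twice. Rows and columns run over ordered pairs, so each proper minor is counted four
  times.\<close>

lemma mtrace_gram_square:
  "mtrace (gram m n M * gram m n M) =
     complex_of_real ((\<Sum>a\<le>m. \<Sum>j\<le>n. (cmod (M a j))\<^sup>2)\<^sup>2 - sum_minors m n M / 2)"
proof -
  have car: "gram m n M \<in> carrier_mat (Suc m) (Suc m)" by (simp add: gram_def)
  let ?S = "\<lambda>f :: nat \<Rightarrow> nat \<Rightarrow> nat \<Rightarrow> nat \<Rightarrow> complex. \<Sum>a\<le>m. \<Sum>b\<le>m. \<Sum>j\<le>n. \<Sum>k\<le>n. f a b j k"
  let ?x = "\<lambda>a b j k. M a j * M b k"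
  let ?T = "mtrace (gram m n M * gram m n M)"
  have T: "?T = ?S (\<lambda>a b j k. ?x a b j k * cnj (?x a b k j))"
    unfolding mtrace_mult[OF car car] lessThan_Suc_atMost
    by (auto simp: gram_def sum_product mult_ac intro!: sum.cong)
  \<comment> \<open>\<open>T'\<close> and \<open>N'\<close> are \<open>T\<close> and
    \<open>N\<close> with the columns \<open>j\<close> and \<open>k\<close> exchanged; all four
    forms occur in the expansion.\<close>
  have T': "?T = ?S (\<lambda>a b j k. ?x a b k j * cnj (?x a b j k))"
    unfolding T by (intro sum.cong refl sum.swap)
  let ?N = "(\<Sum>a\<le>m. \<Sum>j\<le>n. M a j * cnj (M a j))"
  have N: "?N * ?N = ?S (\<lambda>a b j k. ?x a b j k * cnj (?x a b j k))"
    by (simp add: sum_product mult_ac)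
  have N': "?N * ?N = ?S (\<lambda>a b j k. ?x a b k j * cnj (?x a b k j))"
    unfolding N by (intro sum.cong refl sum.swap)
  have "complex_of_real (sum_minors m n M) =
      ?S (\<lambda>a b j k. (?x a b j k * cnj (?x a b j k) + ?x a b k j * cnj (?x a b k j))
         - (?x a b j k * cnj (?x a b k j) + ?x a b k j * cnj (?x a b j k)))"
    unfolding sum_minors_def of_real_sum complex_norm_square
    by (intro sum.cong refl) (simp add: algebra_simps)
  also have "\<dots> = (?N * ?N + ?N * ?N) - (?T + ?T)"
    unfolding sum_subtractf sum.distrib N[symmetric] N'[symmetric] T[symmetric] T'[symmetric] ..
  finally have "complex_of_real (sum_minors m n M) = (?N * ?N + ?N * ?N) - (?T + ?T)" .
  moreover have "?N = complex_of_real (\<Sum>a\<le>m. \<Sum>j\<le>n. (cmod (M a j))\<^sup>2)"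
    unfolding of_real_sum complex_norm_square ..
  ultimately show ?thesis
    by (simp add: power2_eq_square field_simps)
qed

lemma entropy_gram:
  assumes "(\<Sum>a\<le>m. \<Sum>j\<le>n. (cmod (M a j))\<^sup>2) = 1"
  shows "sum_minors m n M / 2 \<le> entropy (gram m n M)"
    and "sum_minors m n M = 0 \<Longrightarrow> entropy (gram m n M) = 0"
proof -
  have tr: "mtrace (gram m n M) = 1" unfolding mtrace_gram assms by simp
  note sq = mtrace_gram_square[of m n M, unfolded assms]
  show "sum_minors m n M / 2 \<le> entropy (gram m n M)"
    using entropy_ge_linear_entropy[of "m + 1" M "{..n}", folded gram_def, OF tr] sq by simp
  show "entropy (gram m n M) = 0" if "sum_minors m n M = 0"
    using entropy_eq_0[of "m + 1" M "{..n}", folded gram_def, OF tr] sq that by simp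
qed

section \<open>The EPOSIC channels\<close>

text \<open>Within \<open>s <= h\<close>, the range of \<open>s\<close> in
  \<open>eposic_coeff\<close> is exactly where both binomials in the sum defining
  \<open>hw_coeff\<close> are nonzero, so it may be extended to all \<open>s <= h\<close>.\<close>

lemma eposic_coeff_eq_hw_coeff:
  assumes "j \<le> h + b" "j \<le> i + h" "i \<le> j + a"
  shows "eposic_coeff (h + a) (h + b) h i j =
    sqrt (eposic_c (h + a) (h + b) h * fact (a + b) * fact (h + a) * fact (h + b)
       / (real ((a + b) choose i) * (real ((h + a) choose (i + h - j)) * real ((h + b) choose j))))
    * hw_coeff h a b (int (i + h - j)) (int j) / fact a"
proof -
  let ?q = "sqrt (eposic_c (h + a) (h + b) h * fact (a + b) * fact (h + a) * fact (h + b)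
       / (real ((a + b) choose i) * (real ((h + a) choose (i + h - j)) * real ((h + b) choose j))))"
  let ?f = "\<lambda>s. (-1) ^ s * real (h choose s) * (ibinom b (int j - int s) * ibinom a (int (i + h - j) - int h + int s))"
  have r: "h + a + (h + b) - 2 * h = a + b" by simp
  let ?I = "{max (j - i) (j + h - (h + b))..min h (min j (j + (h + a) - (i + h)))}"
  have "eposic_coeff (h + a) (h + b) h i j = (\<Sum>s\<in>?I. ?q / fact a * ?f s)"
    unfolding eposic_coeff_def Let_def r
  proof (intro sum.cong refl)
    fix s assume s: "s \<in> ?I"
    then have "int j - int s = int (j - s)" "int (i + h - j) - int h + int s = int (i + s - j)"
      using assms by auto
    then have eq: "?f s = (-1) ^ s * real (h choose s) * (real (b choose (j - s)) * real (a choose (i + s - j)))"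
      by (simp only: ibinom_of_nat)
    then show "(-1) ^ s
        * sqrt (eposic_c (h + a) (h + b) h * fact (a + b) * fact (h + a) * fact (h + b)
                / (real ((a + b) choose i) * real ((h + a) choose (i + h - j)) * real ((h + b) choose j)))
        * (real (h choose s) * real ((h + b - h) choose (j - s)) * real ((h + a - h) choose (i + s - j))
           / fact (h + a - h)) = ?q / fact a * ?f s"
      unfolding eq by (simp add: mult_ac)
  qed
  also have "\<dots> = (\<Sum>s\<le>h. ?q / fact a * ?f s)"
  proof (intro sum.mono_neutral_left ballI)
    fix s assume s: "s \<in> {..h} - ?I"
    have "ibinom b (int j - int s) = 0 \<or> ibinom a (int (i + h - j) - int h + int s) = 0"
    proof (cases "j < s \<or> s + b < j")
      case True
      then show ?thesis by (intro disjI1, intro ibinom_eq_0) linarith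
    next
      case False
      then show ?thesis using s assms by (intro disjI2, intro ibinom_eq_0) auto
    qed
    then show "?q / fact a * ?f s = 0" by auto
  qed auto
  also have "\<dots> = ?q / fact a * hw_coeff h a b (int (i + h - j)) (int j)"
    unfolding hw_coeff_def sum_distrib_left ..
  finally show ?thesis by simp
qed

lemma eposic_c_pos: "eposic_c (h + a) (h + b) h > 0"
  by (simp add: eposic_c_def)

text \<open>The \<open>l\<close>-th coordinate of \<open>T\<^sub>j w\<close>.\<close>

definition eposic_amp :: "nat \<Rightarrow> nat \<Rightarrow> nat \<Rightarrow> (nat \<Rightarrow> complex) \<Rightarrow> nat \<Rightarrow> nat \<Rightarrow> complex" where
  "eposic_amp h a b w l j =
     (if h \<le> l + j \<and> l + j \<le> h + a + b
      then complex_of_real (eposic_coeff (h + a) (h + b) h (l + j - h) j) * w (l + j - h) else 0)"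

text \<open>The sum is a multiple of the weight vector's norm \<open>hw_norm\<close>. Its binomial
  cancels \<open>(a + b) choose i\<close>, and \<open>eposic_c\<close> with the factorials is
  inverse to what remains.\<close>

lemma sum_eposic_coeff_square:
  assumes i: "i \<le> a + b"
  shows "(\<Sum>j\<le>h + b. if j \<le> i + h \<and> i \<le> j + a then (eposic_coeff (h + a) (h + b) h i j)\<^sup>2 else 0) = 1"
proof -
  let ?K = "eposic_c (h + a) (h + b) h * fact (a + b) * fact (h + a) * fact (h + b) / (real ((a + b) choose i) * (fact a)\<^sup>2)"
  let ?g = "\<lambda>j. (hw_coeff h a b (int (h + i) - int j) (int j))\<^sup>2
               / (ibinom (h + a) (int (h + i) - int j) * ibinom (h + b) (int j))"
  have "(\<Sum>j\<le>h + b. if j \<le> i + h \<and> i \<le> j + a then (eposic_coeff (h + a) (h + b) h i j)\<^sup>2 else 0)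
      = (\<Sum>j\<le>h + b. ?K * ?g j)"
  proof (intro sum.cong refl)
    fix j assume "j \<in> {..h + b}"
    then have j: "j \<le> h + b" by simp
    show "(if j \<le> i + h \<and> i \<le> j + a then (eposic_coeff (h + a) (h + b) h i j)\<^sup>2 else 0) = ?K * ?g j"
    proof (cases "j \<le> i + h \<and> i \<le> j + a")
      case True
      then have "int (h + i) - int j = int (i + h - j)" by simp
      then have "?g j = (hw_coeff h a b (int (i + h - j)) (int j))\<^sup>2
               / (real ((h + a) choose (i + h - j)) * real ((h + b) choose j))"
        by (simp only: ibinom_of_nat)
      moreover have "(eposic_coeff (h + a) (h + b) h i j)\<^sup>2 =
          eposic_c (h + a) (h + b) h * fact (a + b) * fact (h + a) * fact (h + b)
          / (real ((a + b) choose i) * (real ((h + a) choose (i + h - j)) * real ((h + b) choose j)))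
          * (hw_coeff h a b (int (i + h - j)) (int j))\<^sup>2 / (fact a)\<^sup>2"
        using True j eposic_c_pos[of h a b]
        by (simp add: eposic_coeff_eq_hw_coeff power_divide power_mult_distrib)
      ultimately show ?thesis using True by (simp add: mult_ac)
    next
      case False
      then have "hw_coeff h a b (int (h + i) - int j) (int j) = 0"
        by (intro hw_coeff_eq_0) auto
      then show ?thesis using False by auto
    qed
  qed
  also have "\<dots> = ?K * hw_norm h a b (int (h + i))"
    unfolding hw_norm_def sum_distrib_left ..
  also have "\<dots> = ?K * (real ((a + b) choose i) * (fact h * fact a * fact b * fact (h + a + b + 1)
       / (fact (h + a) * fact (h + b) * fact (a + b + 1))))"
    unfolding hw_norm_binomial[OF i] hw_norm_lowest_weight ..
  also have "\<dots> = 1"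
  proof -
    define N where "N = (fact (h + a + b + 1) :: real)"
    define R where "R = real (a + b + 1)"
    have "N \<noteq> 0" "R \<noteq> 0" "(fact (a + b + 1) :: real) = R * fact (a + b)"
      unfolding N_def R_def by (simp_all del: of_nat_Suc of_nat_add)
    moreover have "real ((a + b) choose i) > 0" using i by simp
    moreover have "h + a + (h + b) - 2 * h + 1 = a + b + 1" "h + a + (h + b) - h + 1 = h + a + b + 1" by auto
    ultimately show ?thesis
      unfolding eposic_c_def N_def[symmetric]
      by (simp only: R_def[symmetric] N_def[symmetric]) (simp add: power2_eq_square field_simps)
  qed
  finally show ?thesis .
qed

text \<open>The map from \<open>w\<close> to its matrix is an isometry: the \<open>i\<close>-th
  basis vector feeds only the antidiagonal \<open>l + j = i + h\<close>, so there are no cross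
  terms.\<close>

lemma sum_eposic_amp:
  "(\<Sum>l\<le>h + a. \<Sum>j\<le>h + b. (cmod (eposic_amp h a b w l j))\<^sup>2) = (\<Sum>i\<le>a + b. (cmod (w i))\<^sup>2)"
proof -
  let ?e = "\<lambda>i j. (eposic_coeff (h + a) (h + b) h i j)\<^sup>2"
  have "(\<Sum>l\<le>h + a. \<Sum>j\<le>h + b. (cmod (eposic_amp h a b w l j))\<^sup>2)
      = (\<Sum>l\<le>h + a. \<Sum>j\<le>h + b. \<Sum>i\<le>a + b. if l + j = i + h then ?e i j * (cmod (w i))\<^sup>2 else 0)"
  proof (intro sum.cong refl)
    fix l j
    have "(\<Sum>i\<le>a + b. if l + j = i + h then ?e i j * (cmod (w i))\<^sup>2 else 0)
       = (\<Sum>i\<le>a + b. if i = l + j - h then (if h \<le> l + j then ?e i j * (cmod (w i))\<^sup>2 else 0) else 0)"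
      by (intro sum.cong) auto
    also have "\<dots> = (cmod (eposic_amp h a b w l j))\<^sup>2"
      by (auto simp: eposic_amp_def norm_mult power_mult_distrib)
    finally show "(cmod (eposic_amp h a b w l j))\<^sup>2
       = (\<Sum>i\<le>a + b. if l + j = i + h then ?e i j * (cmod (w i))\<^sup>2 else 0)" ..
  qed
  also have "\<dots> = (\<Sum>l\<le>h + a. \<Sum>i\<le>a + b. \<Sum>j\<le>h + b. if l + j = i + h then ?e i j * (cmod (w i))\<^sup>2 else 0)"
    by (intro sum.cong refl sum.swap)
  also have "\<dots> = (\<Sum>i\<le>a + b. \<Sum>l\<le>h + a. \<Sum>j\<le>h + b. if l + j = i + h then ?e i j * (cmod (w i))\<^sup>2 else 0)"
    by (rule sum.swap)
  also have "\<dots> = (\<Sum>i\<le>a + b. \<Sum>j\<le>h + b. \<Sum>l\<le>h + a. if l + j = i + h then ?e i j * (cmod (w i))\<^sup>2 else 0)"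
    by (intro sum.cong refl sum.swap)
  also have "\<dots> = (\<Sum>i\<le>a + b. (cmod (w i))\<^sup>2)"
  proof (intro sum.cong refl)
    fix i assume "i \<in> {..a + b}"
    then have i: "i \<le> a + b" by simp
    have "(\<Sum>l\<le>h + a. if l + j = i + h then ?e i j * (cmod (w i))\<^sup>2 else 0)
       = (if j \<le> i + h \<and> i \<le> j + a then ?e i j else 0) * (cmod (w i))\<^sup>2" for j
    proof -
      have "(\<Sum>l\<le>h + a. if l + j = i + h then ?e i j * (cmod (w i))\<^sup>2 else 0)
       = (\<Sum>l\<le>h + a. if l = i + h - j then (if j \<le> i + h then ?e i j * (cmod (w i))\<^sup>2 else 0) else 0)"
        by (intro sum.cong) auto
      also have "\<dots> = (if j \<le> i + h \<and> i \<le> j + a then ?e i j else 0) * (cmod (w i))\<^sup>2"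
        by auto
      finally show ?thesis .
    qed
    then show "(\<Sum>j\<le>h + b. \<Sum>l\<le>h + a. if l + j = i + h then ?e i j * (cmod (w i))\<^sup>2 else 0) = (cmod (w i))\<^sup>2"
      by (simp only: sum_distrib_right[symmetric] sum_eposic_coeff_square[OF i] mult_1_left)
  qed
  finally show ?thesis .
qed

section \<open>The output state and its matrix of amplitudes\<close>

lemma mat_adjoint_index:
  "i < dim_col A \<Longrightarrow> j < dim_row A \<Longrightarrow> mat_adjoint A $$ (i, j) = conjugate (A $$ (j, i))"
  by (simp add: mat_adjoint_def mat_of_rows_index)

text \<open>Each Kraus summand is the rank-one matrix \<open>(T_j w) (T_j w)*\<close>, and the
  vectors \<open>T_j w\<close> are the columns of the amplitude matrix.\<close>

lemma eposic_proj_onto: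
  fixes w :: "complex vec"
  assumes w: "w \<in> carrier_vec (a + b + 1)"
  shows "eposic (h + a) (h + b) h (proj_onto w) =
    gram (h + a) (h + b) (eposic_amp h a b (\<lambda>i. if i < a + b + 1 then w $ i else 0))"
proof (rule eq_matI)
  let ?w = "\<lambda>i. if i < a + b + 1 then w $ i else 0"
  let ?M = "eposic_amp h a b ?w"
  let ?T = "eposic_kraus (h + a) (h + b) h"
  have T: "?T j \<in> carrier_mat (h + a + 1) (a + b + 1)" for j
    by (simp add: eposic_kraus_def)
  have Tw: "(\<Sum>i<a + b + 1. ?T j $$ (l, i) * w $ i) = ?M l j" if "l \<le> h + a" "j \<le> h + b" for l j
  proof -
    have "(\<Sum>i<a + b + 1. ?T j $$ (l, i) * w $ i) =
       (\<Sum>i<a + b + 1. if i = l + j - h then (if h \<le> l + j then complex_of_real (eposic_coeff (h + a) (h + b) h i j) * w $ i else 0) else 0)"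
      using that by (intro sum.cong) (auto simp: eposic_kraus_def eposic_B_def)
    also have "\<dots> = ?M l j"
      by (auto simp: eposic_amp_def)
    finally show ?thesis .
  qed
  fix x y
  assume "x < dim_row (gram (h + a) (h + b) ?M)" "y < dim_col (gram (h + a) (h + b) ?M)"
  then have x: "x \<le> h + a" and y: "y \<le> h + a" by (auto simp: gram_def)
  have "(?T j * proj_onto w * mat_adjoint (?T j)) $$ (x, y) = ?M x j * cnj (?M y j)" if j: "j \<le> h + b" for j
  proof -
    have p: "proj_onto w \<in> carrier_mat (a + b + 1) (a + b + 1)" using w by (auto simp: proj_onto_def)
    have ad: "mat_adjoint (?T j) \<in> carrier_mat (a + b + 1) (h + a + 1)"
      using T[of j] by (auto simp: mat_adjoint_def)
    have row: "(?T j * proj_onto w) $$ (x, k) = ?M x j * cnj (w $ k)" if k: "k < a + b + 1" for k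
    proof -
      have "(?T j * proj_onto w) $$ (x, k) = (\<Sum>i<a + b + 1. ?T j $$ (x, i) * w $ i * cnj (w $ k))"
        using T[of j] p x k w
        by (simp add: scalar_prod_def atLeast0LessThan proj_onto_def mult_ac del: sum.lessThan_Suc)
      then show ?thesis unfolding Tw[OF x j, symmetric] sum_distrib_right .
    qed
    have "(?T j * proj_onto w * mat_adjoint (?T j)) $$ (x, y)
       = (\<Sum>k<a + b + 1. (?T j * proj_onto w) $$ (x, k) * mat_adjoint (?T j) $$ (k, y))"
      using T[of j] p ad x y
      by (simp add: scalar_prod_def atLeast0LessThan del: sum.lessThan_Suc assoc_mult_mat)
    also have "\<dots> = (\<Sum>k<a + b + 1. ?M x j * cnj (?T j $$ (y, k) * w $ k))"
      using T[of j] y by (intro sum.cong refl) (simp add: row mat_adjoint_index)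
    also have "\<dots> = ?M x j * cnj (?M y j)"
      unfolding Tw[OF y j, symmetric] cnj_sum sum_distrib_left ..
    finally show ?thesis .
  qed
  then show "eposic (h + a) (h + b) h (proj_onto w) $$ (x, y) = gram (h + a) (h + b) ?M $$ (x, y)"
    using x y by (simp add: eposic_def gram_def)
qed (auto simp: eposic_def gram_def)

text \<open>The square roots pass from orthonormal to monomial coordinates. What matters is that
  \<open>c\<close> depends only on \<open>l + j\<close>, so it can be pulled out of antidiagonal
  sums.\<close>

lemma eposic_amp_hw_coeff:
  "\<exists>c. \<forall>l j. l \<le> h + a \<longrightarrow> j \<le> h + b \<longrightarrow>
     complex_of_real (sqrt (real ((h + a) choose l)) * sqrt (real ((h + b) choose j))) * eposic_amp h a b w l j
       = c (l + j) * complex_of_real (hw_coeff h a b (int l) (int j))"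
proof -
  define c where "c k = (if h \<le> k \<and> k \<le> h + a + b
      then complex_of_real (sqrt (eposic_c (h + a) (h + b) h * fact (a + b) * fact (h + a) * fact (h + b)
             / real ((a + b) choose (k - h))) / fact a) * w (k - h) else 0)" for k
  have "complex_of_real (sqrt (real ((h + a) choose l)) * sqrt (real ((h + b) choose j))) * eposic_amp h a b w l j
       = c (l + j) * complex_of_real (hw_coeff h a b (int l) (int j))" if "l \<le> h + a" "j \<le> h + b" for l j
  proof (cases "h \<le> l + j \<and> l + j \<le> h + a + b")
    case True
    define i where "i = l + j - h"
    have l: "l = i + h - j" and i: "j \<le> i + h" "i \<le> j + a" using True that by (auto simp: i_def)
    have "sqrt (real ((h + a) choose l)) * sqrt (real ((h + b) choose j)) > 0"
      using that by simp
    then have "sqrt (real ((h + a) choose l)) * sqrt (real ((h + b) choose j)) * eposic_coeff (h + a) (h + b) h i j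
      = sqrt (eposic_c (h + a) (h + b) h * fact (a + b) * fact (h + a) * fact (h + b)
             / real ((a + b) choose i)) / fact a * hw_coeff h a b (int l) (int j)"
      unfolding eposic_coeff_eq_hw_coeff[OF that(2) i] l[symmetric] using that
      by (simp add: real_sqrt_divide real_sqrt_mult field_simps)
    then have "complex_of_real (sqrt (real ((h + a) choose l)) * sqrt (real ((h + b) choose j)) * eposic_coeff (h + a) (h + b) h i j)
      = complex_of_real (sqrt (eposic_c (h + a) (h + b) h * fact (a + b) * fact (h + a) * fact (h + b)
             / real ((a + b) choose i)) / fact a * hw_coeff h a b (int l) (int j))"
      by (rule arg_cong)
    then show ?thesis
      using True unfolding c_def eposic_amp_def i_def[symmetric] of_real_mult by (simp add: mult_ac)
  next
    case False
    then show ?thesis by (auto simp: c_def eposic_amp_def)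
  qed
  then show ?thesis by blast
qed

text \<open>If all minors vanish, then \<open>M l j * M l\<^sub>0 j\<^sub>0 = M l j\<^sub>0 * M l\<^sub>0 j\<close>, and summing over \<open>l + j = k\<close>
  shows that the product of two nonzero polynomials is zero.\<close>

lemma eposic_amp_not_rank_one:
  assumes h: "h > 0" and w: "(\<Sum>i\<le>a + b. (cmod (w i))\<^sup>2) = 1"
  shows "sum_minors (h + a) (h + b) (eposic_amp h a b w) \<noteq> 0"
proof
  let ?M = "eposic_amp h a b w" and ?m = "h + a" and ?n = "h + b"
  assume Q: "sum_minors ?m ?n ?M = 0"
  have "\<exists>l0 j0. l0 \<le> ?m \<and> j0 \<le> ?n \<and> ?M l0 j0 \<noteq> 0"
  proof (rule ccontr)
    assume "\<not> ?thesis"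
    then have "(\<Sum>l\<le>?m. \<Sum>j\<le>?n. (cmod (?M l j))\<^sup>2) = 0"
      by (intro sum.neutral ballI) auto
    then show False unfolding sum_eposic_amp w by simp
  qed
  then obtain l0 j0 where l0: "l0 \<le> ?m" and j0: "j0 \<le> ?n" and nz: "?M l0 j0 \<noteq> 0" by blast
  obtain c where c: "\<And>l j. l \<le> ?m \<Longrightarrow> j \<le> ?n \<Longrightarrow>
     complex_of_real (sqrt (real (?m choose l)) * sqrt (real (?n choose j))) * ?M l j
       = c (l + j) * complex_of_real (hw_coeff h a b (int l) (int j))"
    using eposic_amp_hw_coeff[of h a b w] by blast
  \<comment> \<open>\<open>u\<close> and \<open>v\<close> are the column \<open>j0\<close> and the
    row \<open>l0\<close> in monomial coordinates, the coefficients of the presumed factors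
    \<open>p\<close> and \<open>q\<close>.\<close>
  define u where "u l = (if l \<le> ?m then complex_of_real (sqrt (real (?m choose l))) * ?M l j0 else 0)" for l
  define v where "v j = (if j \<le> ?n then complex_of_real (sqrt (real (?n choose j))) * ?M l0 j else 0)" for j
  define p where "p = (\<Sum>l\<le>?m. Polynomial.monom (u l) l)"
  define q where "q = (\<Sum>j\<le>?n. Polynomial.monom (v j) j)"
  have cp: "Polynomial.coeff p l = u l" for l
    by (auto simp: p_def coeff_sum u_def)
  have cq: "Polynomial.coeff q j = v j" for j
    by (auto simp: q_def coeff_sum v_def)
  have "Polynomial.coeff (q * p) k = 0" for k
  proof -
    let ?g = "\<lambda>j. hw_coeff h a b (int k - int j) (int j)"
    have uv: "v j * u (k - j) = ?M l0 j0 * c k * complex_of_real (if j \<le> ?n then ?g j else 0)" if j: "j \<le> k" for j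
    proof (cases "j \<le> ?n \<and> k - j \<le> ?m")
      case True
      have "v j * u (k - j) = complex_of_real (sqrt (real (?m choose (k - j))) * sqrt (real (?n choose j)))
           * (?M l0 j * ?M (k - j) j0)"
        using True by (simp add: u_def v_def mult_ac)
      \<comment> \<open>The vanishing minor on rows \<open>l0\<close>, \<open>k - j\<close> and
        columns \<open>j\<close>, \<open>j0\<close> reassembles the general entry of the
        matrix.\<close>
      also have "?M l0 j * ?M (k - j) j0 = ?M l0 j0 * ?M (k - j) j"
        using sum_minors_eq_0D[OF Q l0, of "k - j" j j0] True j0 by simp
      also have "complex_of_real (sqrt (real (?m choose (k - j))) * sqrt (real (?n choose j))) * (?M l0 j0 * ?M (k - j) j)
         = ?M l0 j0 * (c (k - j + j) * complex_of_real (hw_coeff h a b (int (k - j)) (int j)))"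
        using True by (subst c[symmetric]) (auto simp: mult_ac)
      finally show ?thesis using j True by (simp add: of_nat_diff)
    next
      case False
      then have "j \<le> ?n \<Longrightarrow> ?g j = 0"
        using j by (intro hw_coeff_eq_0) auto
      then show ?thesis using False by (auto simp: u_def v_def)
    qed
    have "Polynomial.coeff (q * p) k = (\<Sum>j\<le>k. v j * u (k - j))"
      by (simp add: coeff_mult cp cq)
    also have "\<dots> = ?M l0 j0 * c k * complex_of_real (\<Sum>j\<le>k. if j \<le> ?n then ?g j else 0)"
      unfolding of_real_sum sum_distrib_left by (intro sum.cong refl uv) simp
    also have "(\<Sum>j\<le>k. if j \<le> ?n then ?g j else 0) = (\<Sum>j\<le>?n. ?g j)"
    proof -
      have "(\<Sum>j\<le>k. if j \<le> ?n then ?g j else 0) = sum ?g ({..k} \<inter> {..?n})"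
        by (subst sum.inter_restrict) simp_all
      also have "\<dots> = (\<Sum>j\<le>?n. ?g j)"
        by (intro sum.mono_neutral_left) (auto intro!: hw_coeff_eq_0)
      finally show ?thesis .
    qed
    also have "\<dots> = 0" by (rule sum_hw_coeff_antidiagonal[OF h])
    finally show ?thesis by simp
  qed
  \<comment> \<open>Polynomials over a field have no zero divisors, yet \<open>u l0\<close> and
    \<open>v j0\<close> are nonzero multiples of \<open>?M l0 j0\<close>.\<close>
  then have "q * p = 0" by (intro poly_eqI) simp
  then have "v j0 = 0 \<or> u l0 = 0"
    using cp[of l0] cq[of j0] by auto
  then show False using l0 j0 nz by (auto simp: u_def v_def)
qed

section \<open>Compactness and the conclusion\<close>

lemma continuous_sum_minors_eposic_amp:
  "continuous_on UNIV (\<lambda>w. sum_minors m n (eposic_amp h a b w))"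
proof -
  have "continuous_on UNIV (\<lambda>w. eposic_amp h a b w l j)" for l j
  proof (cases "h \<le> l + j \<and> l + j \<le> h + a + b")
    case True
    then have "(\<lambda>w. eposic_amp h a b w l j) =
        (\<lambda>w. complex_of_real (eposic_coeff (h + a) (h + b) h (l + j - h) j) * w (l + j - h))"
      by (simp add: eposic_amp_def fun_eq_iff)
    then show ?thesis
      by (simp only:) (intro continuous_intros continuous_on_product_coordinates)
  next
    case False
    then have eq: "(\<lambda>w. eposic_amp h a b w l j) = (\<lambda>w. 0)"
      by (auto simp: eposic_amp_def fun_eq_iff)
    show ?thesis unfolding eq by (rule continuous_on_const)
  qed
  note [continuous_intros] = this
  show ?thesis unfolding sum_minors_def by (intro continuous_intros)
qed

lemma unit_vec_norm:
  fixes w :: "complex vec"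
  assumes "w \<in> carrier_vec d" "w \<bullet>c w = 1"
  shows "(\<Sum>i<d. (cmod (w $ i))\<^sup>2) = 1"
proof -
  have "complex_of_real (\<Sum>i<d. (cmod (w $ i))\<^sup>2) = w \<bullet>c w"
    unfolding of_real_sum complex_norm_square using assms(1)
    by (simp add: scalar_prod_def atLeast0LessThan)
  then show ?thesis using assms(2) by (metis of_real_eq_1_iff)
qed

lemma min_output_entropy_eposic_0_iff:
  "min_output_entropy (a + b + 1) (eposic (h + a) (h + b) h) = 0 \<longleftrightarrow> h = 0"
proof -
  let ?d = "a + b + 1"
  define W where "W = {w \<in> carrier_vec ?d. w \<bullet>c w = (1 :: complex)}"
  let ?f = "\<lambda>w :: complex vec. \<lambda>i. if i < ?d then w $ i else 0"
  let ?S = "{w :: nat \<Rightarrow> complex. (\<forall>i\<ge>?d. w i = 0) \<and> (\<Sum>i<?d. (cmod (w i))\<^sup>2) = 1}"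
  let ?Q = "\<lambda>w. sum_minors (h + a) (h + b) (eposic_amp h a b w)"
  let ?E = "\<lambda>w. entropy (eposic (h + a) (h + b) h (proj_onto w))"
  have E: "min_output_entropy ?d (eposic (h + a) (h + b) h) = (INF w\<in>W. ?E w)"
    by (simp add: min_output_entropy_def W_def)
  have S: "?f w \<in> ?S" if "w \<in> W" for w
    using unit_vec_norm[of w ?d] that by (simp add: W_def del: sum.lessThan_Suc)
  have norm1: "(\<Sum>l\<le>h + a. \<Sum>j\<le>h + b. (cmod (eposic_amp h a b w l j))\<^sup>2) = 1" if "w \<in> ?S" for w
    using that unfolding sum_eposic_amp by (simp add: lessThan_Suc_atMost)
  have ge: "?Q (?f w) / 2 \<le> ?E w" if "w \<in> W" for w
    using that S[OF that] eposic_proj_onto[of w a b h] entropy_gram(1)[OF norm1, of "?f w"]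
    by (simp add: W_def)
  have e0: "unit_vec ?d 0 \<in> W"
    by (simp add: W_def scalar_prod_left_unit)
  show ?thesis
  proof (cases "h = 0")
    case True
    \<comment> \<open>For \<open>h = 0\<close> the amplitude matrix of the lowest weight vector is
      zero outside the entry \<open>(0, 0)\<close>, so its rank is at most one.\<close>
    have "?Q (?f (unit_vec ?d 0)) = 0"
      by (auto simp: sum_minors_def eposic_amp_def True)
    then have z: "?E (unit_vec ?d 0) = 0"
      using eposic_proj_onto[of "unit_vec ?d 0" a b h] entropy_gram(2)[OF norm1[OF S[OF e0]]]
      by simp
    have nonneg: "?E w \<ge> 0" if "w \<in> W" for w
      using ge[OF that] sum_minors_nonneg[of "h + a" "h + b"] by (smt (verit) divide_nonneg_pos)
    have "(INF w\<in>W. ?E w) = 0"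
    proof (rule antisym)
      show "(INF w\<in>W. ?E w) \<le> 0"
        using e0 z nonneg by (intro cINF_lower2[of _ _ "unit_vec ?d 0"]) (auto intro!: bdd_belowI2[of _ 0])
      show "0 \<le> (INF w\<in>W. ?E w)"
        using e0 nonneg by (intro cINF_greatest) auto
    qed
    then show ?thesis using True E by simp
  next
    case False
    \<comment> \<open>Continuity is needed only for the minors: their minimum on the sphere gives a
      uniform positive lower bound for the entropy.\<close>
    obtain u where u: "u \<in> ?S" "\<And>v. v \<in> ?S \<Longrightarrow> ?Q u \<le> ?Q v"
      using continuous_attains_inf_unit_sphere[of ?d ?Q, OF _ continuous_sum_minors_eposic_amp] by auto
    have "?Q u \<noteq> 0"
      using False u(1) by (intro eposic_amp_not_rank_one) (simp_all add: lessThan_Suc_atMost)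
    then have "0 < ?Q u / 2"
      using sum_minors_nonneg[of "h + a" "h + b" "eposic_amp h a b u"] by simp
    also have "?Q u / 2 \<le> (INF w\<in>W. ?E w)"
    proof (rule cINF_greatest)
      show "W \<noteq> {}" using e0 by blast
      fix w assume w: "w \<in> W"
      show "?Q u / 2 \<le> ?E w"
        using u(2)[OF S[OF w]] ge[OF w] by simp
    qed
    finally show ?thesis using False E by simp
  qed
qed

theorem theorem2p16:
  fixes m n h :: nat
  assumes "h \<le> min m n"
  shows "min_output_entropy (m + n - 2 * h + 1) (eposic m n h) = 0 \<longleftrightarrow> h = 0"
proof -
  \<comment> \<open>Putting \<open>m = h + a\<close> and \<open>n = h + b\<close> removes the
    truncated differences.\<close>
  obtain a b where "m = h + a" "n = h + b"
    using assms by (auto dest!: le_Suc_ex)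
  moreover have "h + a + (h + b) - 2 * h + 1 = a + b + 1" by simp
  ultimately show ?thesis
    using min_output_entropy_eposic_0_iff[of a b h] by simp
qed

end
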